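(* Let $n\ge 0$ be an integer, and let $p,q\in\mathbb{R}[t]$ be polynomials of degree at most $2$ such that $\{p,q,1\}$ is linearly independent over $\mathbb{R}$ (equivalently, the convex curve $C=\{(p(t),q(t)) : t\in\mathbb{R}\}$ is not contained in a line). Let $a,b\in\mathbb{R}$ with $b\neq 0$, and let $v_i:=(p(a+ib),\,q(a+ib))\in\mathbb{R}^2$ for $i=0,1,\dots,n+2$ be equally-spaced points on $C$. Let $Q:=\mathrm{conv}\{v_0,\dots,v_{n+2}\}$, a convex $(n+3)$-gon with vertices $v_0,\dots,v_{n+2}$. Let $e_1,\dots,e_{n+2}$ be the standard basis of $\mathbb{R}^{n+2}$ and put $f_i:=e_1+\dots+e_i$ for $i=0,\dots,n+2$ (so $f_0=0$). Then all vertices of the secondary polytope $$\mathrm{Ass}_n(Q)=\mathrm{conv}\Big\{\sum_{i=0}^{n+2}\ \sum_{\sigma\in T\,:\,i\in\sigma}\mathrm{vol}(\sigma)\,f_i \ :\ T\text{ is a triangulation of }Q\Big\}\subset\mathbb{R}^{n+2}$$ lie on one common sphere centered at the origin; that is, they all have the same Euclidean norm.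
   Context: A triangulation $T$ of the convex polygon $Q$ with vertices $v_0,\dots,v_{n+2}$ is a subdivision of $Q$ into triangles by pairwise non-crossing diagonals, using only the vertices of $Q$ as vertices. It is regarded as the set of its triangles $\sigma$. The notation $i\in\sigma$ means that $v_i$ is a vertex of the triangle $\sigma$, and $\mathrm{vol}(\sigma)$ is the Euclidean area of $\sigma$. The points $f_0,\dots,f_{n+2}$ are the vertices of an $(n+2)$-dimensional simplex. *)

theory Defs
  imports "HOL-Analysis.Analysis" "HOL-Computational_Algebra.Polynomial"
begin

definition diagonal_of :: "(real^2) set \<Rightarrow> (real^2) set \<Rightarrow> bool" (infix \<open>diagonal'_of\<close> 50)
  where "d diagonal_of Q \<longleftrightarrow>
    (\<exists>x y. x extreme_point_of Q \<and> y extreme_point_of Q \<and> x \<noteq> y \<and>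
      d = closed_segment x y \<and> \<not> d face_of Q)"

text \<open>
  Diagonals may share end points, so non-crossing concerns their relative interiors.
  The last conjunct says that the only lines of subdivision are the non-crossing diagonals
  \<open>D\<close>. It records the usual description of a triangulation of a polygon and excludes nothing:
  it already follows from the other conjuncts, since \<^const>\<open>triangulation\<close> requires
  any two triangles to meet in a common face.
\<close>
definition polygon_triangulation :: "(real^2) set \<Rightarrow> (real^2) set set \<Rightarrow> bool"
  where "polygon_triangulation Q T \<longleftrightarrow>
    triangulation T \<and> \<Union>T = Q \<and>
    (\<forall>\<sigma>\<in>T. 2 simplex \<sigma>) \<and>
    (\<forall>\<sigma>\<in>T. \<forall>x. x extreme_point_of \<sigma> \<longrightarrow> x extreme_point_of Q) \<and>
    (\<exists>D. (\<forall>d\<in>D. d diagonal_of Q) \<and>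
         pairwise (\<lambda>d d'. rel_interior d \<inter> rel_interior d' = {}) D \<and>
         (\<forall>\<sigma>\<in>T. \<forall>s. s edge_of \<sigma> \<longrightarrow> s edge_of Q \<or> s \<in> D))"

definition curve_point :: "real poly \<Rightarrow> real poly \<Rightarrow> real \<Rightarrow> real \<Rightarrow> nat \<Rightarrow> real^2"
  where "curve_point p q a b i = vector [poly p (a + real i * b), poly q (a + real i * b)]"

definition staircase :: "(nat \<Rightarrow> real^'d::finite) \<Rightarrow> nat \<Rightarrow> real^'d"
  where "staircase e i = (\<Sum>j=1..i. e j)"

text \<open>
  The point \<open>\<Sum>\<^sub>i \<Sum>\<^sub>\<sigma> vol(\<sigma>) f\<^sub>i\<close> attached to \<open>T\<close>, for vertices \<open>v\<^sub>0, \<dots>, v\<^sub>m\<close>.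
\<close>
definition area_vector ::
  "nat \<Rightarrow> (nat \<Rightarrow> real^2) \<Rightarrow> (nat \<Rightarrow> real^'d::finite) \<Rightarrow> (real^2) set set \<Rightarrow> real^'d"
  where "area_vector m v f T =
    (\<Sum>i=0..m. \<Sum>\<sigma> | \<sigma> \<in> T \<and> v i extreme_point_of \<sigma>. measure lborel \<sigma> *\<^sub>R f i)"

definition secondary_polytope ::
  "nat \<Rightarrow> (nat \<Rightarrow> real^2) \<Rightarrow> (nat \<Rightarrow> real^'d::finite) \<Rightarrow> (real^'d) set"
  where "secondary_polytope m v f =
    convex hull {area_vector m v f T | T. polygon_triangulation (convex hull (v ` {0..m})) T}"

end

theory Submission
  imports Defs
begin

text \<open>
  Up to an affine map the vertices are \<open>(k, k\<^sup>2)\<close>, so the triangle on \<open>i < j < k\<close> has area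
  proportional to \<open>(j - i) (k - j) (k - i)\<close>. The \<open>j\<close>-th coordinate of the vector of \<open>T\<close> is the
  sum over all triangles of the area times the number of vertices with index at least \<open>j\<close>.
  Cutting along the triangle \<open>{lo, l, hi}\<close> on the chord from \<open>lo\<close> to \<open>hi\<close>, the coordinates are those
  of the two smaller triangulations, each shifted by a constant. Hence the total area, the sum of the
  coordinates and the sum of their squares satisfy a joint recursion, which is solved by polynomials
  in \<open>hi - lo\<close> whatever \<open>l\<close> is.
\<close>

subsection \<open>Triangulations of an interval of indices\<close>

definition load :: "(nat set \<Rightarrow> real) \<Rightarrow> nat set set \<Rightarrow> nat \<Rightarrow> real"
  where "load g F j = (\<Sum>A\<in>F. g A * real (card {i\<in>A. j \<le> i}))"

lemma load_Un:
  assumes "finite F" "finite G" "F \<inter> G = {}"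
  shows "load g (F \<union> G) j = load g F j + load g G j"
  using assms by (simp add: load_def sum.union_disjoint)

lemma load_insert:
  assumes "finite F" "A \<notin> F"
  shows "load g (insert A F) j = g A * real (card {i\<in>A. j \<le> i}) + load g F j"
  using assms by (simp add: load_def)

lemma load_above:
  assumes "\<And>A i. A \<in> F \<Longrightarrow> i \<in> A \<Longrightarrow> i < j"
  shows "load g F j = 0"
proof -
  have "{i\<in>A. j \<le> i} = {}" if "A \<in> F" for A
    using assms that by force
  then show ?thesis unfolding load_def by (intro sum.neutral) (simp del: Collect_empty_eq)
qed

lemma load_below:
  assumes "\<And>A. A \<in> F \<Longrightarrow> card A = 3" "\<And>A i. A \<in> F \<Longrightarrow> i \<in> A \<Longrightarrow> j \<le> i"
  shows "load g F j = 3 * sum g F"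
proof -
  have "{i\<in>A. j \<le> i} = A" if "A \<in> F" for A
    using assms(2) that by force
  then show ?thesis
    unfolding load_def sum_distrib_left by (intro sum.cong) (simp_all add: assms(1))
qed

text \<open>The geometry enters the recursion only through these axioms. \<open>below_edge\<close>
  is the trace of covering: an edge that cuts off vertices between its ends has a triangle on that
  side.\<close>

locale interval_triangulation =
  fixes \<T> :: "nat set set" and g :: "nat set \<Rightarrow> real" and C :: real
  assumes finite_family: "finite \<T>"
    and card3: "A \<in> \<T> \<Longrightarrow> card A = 3"
    and noncrossing: "\<lbrakk>A \<in> \<T>; B \<in> \<T>; a \<in> A; b \<in> A; c \<in> B; d \<in> B; a < c; c < b; b < d\<rbrakk> \<Longrightarrow> False"
    and below_edge: "\<lbrakk>A \<in> \<T>; i \<in> A; j \<in> A; Suc i < j\<rbrakk> \<Longrightarrow> \<exists>l. i < l \<and> l < j \<and> {i, l, j} \<in> \<T>"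
    and weight: "\<lbrakk>i < j; j < k\<rbrakk> \<Longrightarrow>
      g {i, j, k} = C * ((real j - real i) * (real k - real j) * (real k - real i))"
begin

definition inside :: "nat \<Rightarrow> nat \<Rightarrow> nat set set"
  where "inside lo hi = {A \<in> \<T>. A \<subseteq> {lo..hi}}"

lemma finite_inside: "finite (inside lo hi)"
  using finite_family by (simp add: inside_def)

lemma card_inside: "A \<in> inside lo hi \<Longrightarrow> card A = 3"
  using card3 by (simp add: inside_def)

lemma inside_Suc: "inside lo (Suc lo) = {}"
proof -
  have False if "A \<in> \<T>" "A \<subseteq> {lo..Suc lo}" for A
    using card_mono[OF _ that(2)] card3[OF that(1)] by simp
  then show ?thesis by (auto simp: inside_def)
qed

text \<open>A triangle with vertices on both sides of \<open>l\<close> must be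
  \<open>{lo, l, hi}\<close>: a further vertex below \<open>l\<close> would give an edge crossing
  the one from \<open>lo\<close> to \<open>l\<close>, and symmetrically above
  \<open>l\<close>.\<close>

lemma inside_split:
  assumes T: "{lo, l, hi} \<in> \<T>" and "lo < l" "l < hi"
  shows "inside lo hi = insert {lo, l, hi} (inside lo l \<union> inside l hi)"
proof
  show "insert {lo, l, hi} (inside lo l \<union> inside l hi) \<subseteq> inside lo hi"
    using assms by (auto simp: inside_def)
  show "inside lo hi \<subseteq> insert {lo, l, hi} (inside lo l \<union> inside l hi)"
  proof
    fix B assume B: "B \<in> inside lo hi"
    then have BT: "B \<in> \<T>" and sub: "B \<subseteq> {lo..hi}" by (auto simp: inside_def)
    show "B \<in> insert {lo, l, hi} (inside lo l \<union> inside l hi)"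
    proof (rule ccontr)
      assume "\<not> ?thesis"
      then have ne: "B \<noteq> {lo, l, hi}" and "\<not> B \<subseteq> {lo..l}" "\<not> B \<subseteq> {l..hi}"
        using BT by (auto simp: inside_def)
      then obtain a c where a: "a \<in> B" "a < l" and c: "c \<in> B" "l < c"
        using sub by fastforce
      have left: "x = lo" if "x \<in> B" "x < l" for x
        using noncrossing[OF T BT, of lo l x c] that c sub by fastforce
      have right: "x = hi" if "x \<in> B" "l < x" for x
        using noncrossing[OF BT T, of a x l hi] that a sub by fastforce
      have "B \<subseteq> {lo, l, hi}"
        using left right by (metis insertCI linorder_cases subsetI)
      moreover have "card {lo, l, hi} = 3" using assms by simp
      ultimately show False
        using ne card3[OF BT] by (metis card_subset_eq finite.emptyI finite.insertI)
    qed
  qed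
qed

lemma inside_disjoint:
  assumes "lo < l" "l < hi"
  shows "inside lo l \<inter> inside l hi = {}" "{lo, l, hi} \<notin> inside lo l \<union> inside l hi"
proof -
  have False if "A \<in> \<T>" "A \<subseteq> {lo..l}" "A \<subseteq> {l..hi}" for A
  proof -
    have "A \<subseteq> {l}" using that by force
    then show False using card_mono[of "{l}" A] card3[OF that(1)] by simp
  qed
  then show "inside lo l \<inter> inside l hi = {}"
    by (auto simp: inside_def)
  show "{lo, l, hi} \<notin> inside lo l \<union> inside l hi"
    using assms by (auto simp: inside_def)
qed

text \<open>The three sums are proved together because squaring a shifted load brings in the plain
  sum of loads, and the shift brings in the total weight. The disjunction is what
  \<open>below_edge\<close> supplies for both shorter chords.\<close>

lemma load_sums:
  assumes "lo < hi" "hi = Suc lo \<or> (\<exists>l. lo < l \<and> l < hi \<and> {lo, l, hi} \<in> \<T>)"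
  defines "L \<equiv> real hi - real lo"
  shows "sum g (inside lo hi) = C * ((L ^ 3 - L) / 3)
    \<and> (\<Sum>j\<in>{lo<..hi}. load g (inside lo hi) j) = C * (L ^ 2 * (L ^ 2 - 1) / 2)
    \<and> (\<Sum>j\<in>{lo<..hi}. (load g (inside lo hi) j)\<^sup>2)
        = C\<^sup>2 * (2/7 * L ^ 7 - 3/5 * L ^ 5 + 1/3 * L ^ 3 - 2/105 * L)"
  using assms(1,2) unfolding L_def
proof (induction "hi - lo" arbitrary: lo hi rule: less_induct)
  case less
  show ?case
  proof (cases "hi = Suc lo")
    case True
    have "{lo<..Suc lo} = {Suc lo}" by auto
    then show ?thesis using True by (simp add: inside_Suc load_def)
  next
    case False
    then obtain l where l: "lo < l" "l < hi" and T: "{lo, l, hi} \<in> \<T>"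
      using less.prems by blast
    let ?G = "inside lo l" and ?H = "inside l hi"
    define x y where "x = real l - real lo" and "y = real hi - real l"
    have xy: "real hi - real lo = x + y" by (simp add: x_def y_def)
    have "l = Suc lo \<or> (\<exists>k. lo < k \<and> k < l \<and> {lo, k, l} \<in> \<T>)"
      using below_edge[OF T, of lo l] l by force
    then have G: "sum g ?G = C * ((x ^ 3 - x) / 3)"
      "(\<Sum>j\<in>{lo<..l}. load g ?G j) = C * (x ^ 2 * (x ^ 2 - 1) / 2)"
      "(\<Sum>j\<in>{lo<..l}. (load g ?G j)\<^sup>2) = C\<^sup>2 * (2/7 * x ^ 7 - 3/5 * x ^ 5 + 1/3 * x ^ 3 - 2/105 * x)"
      using less.hyps[of l lo] l by (auto simp: x_def)
    have "hi = Suc l \<or> (\<exists>k. l < k \<and> k < hi \<and> {l, k, hi} \<in> \<T>)"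
      using below_edge[OF T, of l hi] l by force
    then have H: "sum g ?H = C * ((y ^ 3 - y) / 3)"
      "(\<Sum>j\<in>{l<..hi}. load g ?H j) = C * (y ^ 2 * (y ^ 2 - 1) / 2)"
      "(\<Sum>j\<in>{l<..hi}. (load g ?H j)\<^sup>2) = C\<^sup>2 * (2/7 * y ^ 7 - 3/5 * y ^ 5 + 1/3 * y ^ 3 - 2/105 * y)"
      using less.hyps[of hi l] l by (auto simp: y_def)
    define A where "A = C * (x * y * (x + y))"
    have gT: "g {lo, l, hi} = A"
      using weight[OF l] by (simp add: A_def x_def y_def)
    note split = inside_split[OF T l] and disj = inside_disjoint[OF l]
    have sum: "sum g (inside lo hi) = A + sum g ?G + sum g ?H"
      unfolding split using disj finite_inside gT by (simp add: sum.union_disjoint)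
    \<comment> \<open>Shift on the left: for \<open>j\<close> up to \<open>l\<close>, the root
      triangle counts two vertices and every triangle of \<open>?H\<close> counts all three.\<close>
    define P where "P = 2 * A + 3 * sum g ?H"
    have load: "load g (inside lo hi) j =
        A * real (card {i \<in> {lo, l, hi}. j \<le> i}) + load g ?G j + load g ?H j" for j
      unfolding split using disj finite_inside gT by (simp add: load_insert load_Un)
    have left: "load g (inside lo hi) j = P + load g ?G j" if "j \<in> {lo<..l}" for j
    proof -
      have "{i \<in> {lo, l, hi}. j \<le> i} = {l, hi}" using that l by auto
      moreover have "load g ?H j = 3 * sum g ?H"
        using that by (intro load_below card_inside) (auto simp: inside_def)
      ultimately show ?thesis using l by (simp add: load P_def)
    qed
    \<comment> \<open>To the right of \<open>l\<close> only \<open>hi\<close> counts in the root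
      triangle, and the triangles of \<open>?G\<close> count nothing.\<close>
    have right: "load g (inside lo hi) j = A + load g ?H j" if "j \<in> {l<..hi}" for j
    proof -
      have "{i \<in> {lo, l, hi}. j \<le> i} = {hi}" using that l by auto
      moreover have "load g ?G j = 0"
        using that by (intro load_above) (force simp: inside_def)
      ultimately show ?thesis by (simp add: load)
    qed
    have un: "{lo<..hi} = {lo<..l} \<union> {l<..hi}" using l by auto
    have "(\<Sum>j\<in>{lo<..hi}. load g (inside lo hi) j) =
        (\<Sum>j\<in>{lo<..l}. P + load g ?G j) + (\<Sum>j\<in>{l<..hi}. A + load g ?H j)"
      unfolding un by (subst sum.union_disjoint) (auto simp: left right)
    then have S: "(\<Sum>j\<in>{lo<..hi}. load g (inside lo hi) j) =
        x * P + (\<Sum>j\<in>{lo<..l}. load g ?G j) + y * A + (\<Sum>j\<in>{l<..hi}. load g ?H j)"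
      using l by (simp add: sum.distrib x_def y_def)
    have "(\<Sum>j\<in>{lo<..hi}. (load g (inside lo hi) j)\<^sup>2) =
        (\<Sum>j\<in>{lo<..l}. (P + load g ?G j)\<^sup>2) + (\<Sum>j\<in>{l<..hi}. (A + load g ?H j)\<^sup>2)"
      unfolding un by (subst sum.union_disjoint) (auto simp: left right)
    then have N: "(\<Sum>j\<in>{lo<..hi}. (load g (inside lo hi) j)\<^sup>2) =
        x * P\<^sup>2 + 2 * P * (\<Sum>j\<in>{lo<..l}. load g ?G j) + (\<Sum>j\<in>{lo<..l}. (load g ?G j)\<^sup>2)
        + y * A\<^sup>2 + 2 * A * (\<Sum>j\<in>{l<..hi}. load g ?H j) + (\<Sum>j\<in>{l<..hi}. (load g ?H j)\<^sup>2)"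
      using l by (simp add: power2_sum sum.distrib x_def y_def
          flip: sum_distrib_left)
    \<comment> \<open>What remains are polynomial identities in \<open>x\<close> and
      \<open>y\<close>. The claimed values involve only \<open>x + y\<close>, so the choice of
      \<open>l\<close> leaves no trace.\<close>
    show ?thesis
      unfolding xy sum S N G H P_def A_def
      by (intro conjI) (simp_all add: field_simps power2_eq_square power_numeral_reduce)
  qed
qed

end

subsection \<open>Triangulations of points on a parabola\<close>

lemma vec2_inner: "(x :: real^2) \<bullet> y = x $ 1 * y $ 1 + x $ 2 * y $ 2"
  by (simp add: inner_vec_def sum_2)

lemma convex_hull_affine_ge:
  fixes w :: "'a::real_inner"
  assumes "x \<in> convex hull S" "\<And>y. y \<in> S \<Longrightarrow> 0 \<le> w \<bullet> y + c"
  shows "0 \<le> w \<bullet> x + c"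
proof -
  have "convex hull S \<subseteq> {y. w \<bullet> y \<ge> - c}"
    using assms(2) by (intro hull_minimal convex_halfspace_ge) force
  then show ?thesis using assms(1) by force
qed

locale quadratic_points =
  fixes v :: "nat \<Rightarrow> real^2" and u0 u1 u2 :: "real^2"
  assumes v_eq: "v k = u0 + real k *\<^sub>R u1 + (real k)\<^sup>2 *\<^sub>R u2"
    and det_nonzero: "u1 $ 1 * u2 $ 2 - u2 $ 1 * u1 $ 2 \<noteq> 0"
begin

definition dt :: real
  where "dt = u1 $ 1 * u2 $ 2 - u2 $ 1 * u1 $ 2"

lemma monic_quadratic:
  obtains w c where "\<And>k. w \<bullet> v k + c = (real k)\<^sup>2 + \<alpha> * real k + \<beta>"
proof
  \<comment> \<open>Cramer's rule for the system \<open>w \<bullet> u1 = \<alpha>\<close>,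
    \<open>w \<bullet> u2 = 1\<close>.\<close>
  define w :: "real^2" where
    "w = vector [(\<alpha> * u2 $ 2 - u1 $ 2) / dt, (u1 $ 1 - \<alpha> * u2 $ 1) / dt]"
  have "w \<bullet> u1 = (\<alpha> * (u1 $ 1 * u2 $ 2 - u2 $ 1 * u1 $ 2)) / dt"
    by (simp add: w_def vec2_inner add_divide_distrib diff_divide_distrib algebra_simps)
  then have 1: "w \<bullet> u1 = \<alpha>" using det_nonzero by (simp add: dt_def)
  have "w \<bullet> u2 = (u1 $ 1 * u2 $ 2 - u2 $ 1 * u1 $ 2) / dt"
    by (simp add: w_def vec2_inner add_divide_distrib diff_divide_distrib algebra_simps)
  then have 2: "w \<bullet> u2 = 1" using det_nonzero by (simp add: dt_def)
  show "w \<bullet> v k + (\<beta> - w \<bullet> u0) = (real k)\<^sup>2 + \<alpha> * real k + \<beta>" for k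
    by (simp add: v_eq inner_add_right 1 2)
qed

text \<open>The zero line is a chord: if \<alpha> and \<beta> are indices, the functional is
  negative exactly at the vertices strictly between them; if they are equal, the line is a
  supporting line. The separation arguments below choose their lines in this way.\<close>

lemma split_quadratic:
  obtains w c where "\<And>k. w \<bullet> v k + c = (real k - \<alpha>) * (real k - \<beta>)"
proof -
  obtain w c where "\<And>k. w \<bullet> v k + c = (real k)\<^sup>2 + - (\<alpha> + \<beta>) * real k + \<alpha> * \<beta>"
    using monic_quadratic[of "- (\<alpha> + \<beta>)" "\<alpha> * \<beta>"] by blast
  then show ?thesis
    by (intro that[of w c]) (simp add: algebra_simps power2_eq_square)
qed

section \<open>Hulls of index sets, their vertices and areas\<close>

lemma inj_v: "inj v"
proof (rule injI, rule ccontr)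
  fix i j assume eq: "v i = v j" and ne: "i \<noteq> j"
  obtain w c where w: "\<And>k. w \<bullet> v k + c = (real k - real i) * (real k - real i)"
    using split_quadratic[of "real i" "real i"] by blast
  show False using w[of i] w[of j] eq ne by simp
qed

text \<open>The index set may have any size: \<open>tri {0..m}\<close> is the whole polygon.\<close>

definition tri :: "nat set \<Rightarrow> (real^2) set"
  where "tri A = convex hull (v ` A)"

text \<open>The functional with values \<open>(k - i)^2\<close> is 0 at \<open>v i\<close> and, the
  indices being integers, at least 1 at every other vertex. This separates \<open>v i\<close>
  strictly from the hull of the others.\<close>

lemma vertex_in_tri_iff:
  "v i \<in> tri A \<longleftrightarrow> i \<in> A"
proof
  show "i \<in> A \<Longrightarrow> v i \<in> tri A" by (simp add: tri_def hull_inc)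
next
  assume vi: "v i \<in> tri A"
  obtain w c where w: "\<And>k. w \<bullet> v k + c = (real k - real i) * (real k - real i)"
    using split_quadratic[of "real i" "real i"] by blast
  show "i \<in> A"
  proof (rule ccontr)
    assume "i \<notin> A"
    have "1 \<le> (real k - real i) * (real k - real i)" if "k \<in> A" for k
    proof -
      have "1 \<le> \<bar>real k - real i\<bar>" using that \<open>i \<notin> A\<close> by (cases k i rule: linorder_cases) auto
      then have "1 * 1 \<le> \<bar>real k - real i\<bar> * \<bar>real k - real i\<bar>" by (intro mult_mono) auto
      then show ?thesis by (simp flip: abs_mult)
    qed
    then have "0 \<le> w \<bullet> v k + (c - 1)" if "k \<in> A" for k
      using w[of k] that by fastforce
    then have "0 \<le> w \<bullet> v i + (c - 1)"
      by (intro convex_hull_affine_ge[OF vi[unfolded tri_def]]) blast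
    then show False using w[of i] by simp
  qed
qed

lemma extreme_point_of_tri_iff:
  assumes "finite A"
  shows "x extreme_point_of tri A \<longleftrightarrow> x \<in> v ` A"
  unfolding tri_def
proof (rule extreme_point_of_convex_hull_convex_independent)
  show "compact (v ` A)" using assms by (simp add: finite_imp_compact)
  show "a \<notin> convex hull (v ` A - {a})" if "a \<in> v ` A" for a
  proof -
    from that obtain i where i: "a = v i" "i \<in> A" by auto
    have "v ` A - {a} = v ` (A - {i})" using inj_v i by (auto dest: injD)
    then show ?thesis using vertex_in_tri_iff[of i "A - {i}"] i by (simp add: tri_def)
  qed
qed

lemma inj_tri: "inj tri"
  by (rule injI) (metis vertex_in_tri_iff subsetI subset_antisym)

text \<open>The area is half an absolute determinant, which for quadratic points is, up to sign,
  \<open>dt\<close> times a Vandermonde product.\<close>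

lemma measure_tri:
  assumes "i < j" "j < k"
  shows "measure lborel (tri {i, j, k}) =
    \<bar>dt\<bar> / 2 * ((real j - real i) * (real k - real j) * (real k - real i))"
proof -
  define w where "w = (real j - real i) * (real k - real j) * (real k - real i)"
  have "(v k $ 1 - v i $ 1) * (v j $ 2 - v i $ 2) - (v j $ 1 - v i $ 1) * (v k $ 2 - v i $ 2)
      = - (dt * w)"
    by (simp add: v_eq dt_def w_def) algebra
  moreover have "\<bar>w\<bar> = w" using assms by (simp add: w_def)
  ultimately show ?thesis
    by (simp add: tri_def content_triangle abs_mult flip: w_def)
qed

section \<open>Crossing chords and triangles next to a chord\<close>

text \<open>On the parabola y = x^2 the chord over a and b lies on the line y = (a + b) x - a b.
  Equating two such lines gives the abscissa of the crossing point, and the interlacing order puts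
  it inside both intervals.\<close>

lemma chords_meet:
  assumes "a < c" "c < b" "b < d"
  obtains x where "x \<in> open_segment (v a) (v b)" "x \<in> open_segment (v c) (v d)"
proof -
  define A B C D where "A = real a" and "B = real b" and "C = real c" and "D = real d"
  have ord: "A < C" "C < B" "B < D" using assms by (simp_all add: A_def B_def C_def D_def)
  have pos: "0 < B - A" "0 < D - C" "0 < C + D - A - B" using ord by linarith+
  \<comment> \<open>the first coordinate of the crossing point, relative to the basis \<open>u1\<close>, \<open>u2\<close>\<close>
  define X where "X = (C * D - A * B) / (C + D - A - B)"
  have XE: "(C + D - A - B) * X = C * D - A * B"
    using pos by (simp add: X_def)
  have betw: "A < X" "X < B" "C < X" "X < D"
  proof -
    have "0 < (X - A) * (C + D - A - B)" "0 < (B - X) * (C + D - A - B)"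
      "0 < (X - C) * (C + D - A - B)" "0 < (D - X) * (C + D - A - B)"
    proof -
      have "(X - A) * (C + D - A - B) = (C - A) * (D - A)"
        "(B - X) * (C + D - A - B) = (B - C) * (D - B)"
        "(X - C) * (C + D - A - B) = (C - A) * (B - C)"
        "(D - X) * (C + D - A - B) = (D - A) * (D - B)"
        using XE by algebra+
      then show "0 < (X - A) * (C + D - A - B)" "0 < (B - X) * (C + D - A - B)"
        "0 < (X - C) * (C + D - A - B)" "0 < (D - X) * (C + D - A - B)"
        using ord by simp_all
    qed
    then show "A < X" "X < B" "C < X" "X < D"
      using pos(3) by (simp_all add: zero_less_mult_iff)
  qed
  define s t where "s = (X - A) / (B - A)" and "t = (X - C) / (D - C)"
  have X: "(1 - s) * A + s * B = X" "(1 - t) * C + t * D = X"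
  proof -
    have "s * (B - A) = X - A" "t * (D - C) = X - C" using pos by (simp_all add: s_def t_def)
    then show "(1 - s) * A + s * B = X" "(1 - t) * C + t * D = X" by algebra+
  qed
  have bounds: "0 < s" "s < 1" "0 < t" "t < 1"
    using pos betw by (simp_all add: s_def t_def)
  have comb: "(1 - r) *\<^sub>R v i + r *\<^sub>R v j = u0 + ((1 - r) * real i + r * real j) *\<^sub>R u1
      + ((1 - r) * (real i)\<^sup>2 + r * (real j)\<^sup>2) *\<^sub>R u2" for r i j
    by (simp add: v_eq algebra_simps)
  \<comment> \<open>Both sides are the height of the crossing point, read off the two lines at
    \<open>X\<close>.\<close>
  have "(1 - s) * A\<^sup>2 + s * B\<^sup>2 = (1 - t) * C\<^sup>2 + t * D\<^sup>2"
  proof -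
    have "(1 - s) * A\<^sup>2 + s * B\<^sup>2 = (A + B) * X - A * B"
      unfolding X(1)[symmetric] by algebra
    moreover have "(1 - t) * C\<^sup>2 + t * D\<^sup>2 = (C + D) * X - C * D"
      unfolding X(2)[symmetric] by algebra
    ultimately show ?thesis using XE by algebra
  qed
  then have eq: "(1 - s) *\<^sub>R v a + s *\<^sub>R v b = (1 - t) *\<^sub>R v c + t *\<^sub>R v d"
    unfolding comb using X by (simp add: A_def B_def C_def D_def)
  have "v a \<noteq> v b" "v c \<noteq> v d" using assms inj_v by (auto dest: injD)
  then show ?thesis
    using eq bounds
    by (intro that[of "(1 - s) *\<^sub>R v a + s *\<^sub>R v b"]) (auto simp: in_segment)
qed

text \<open>Turns covering into the existence of a triangle. The assumption \<open>sides\<close>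
  will follow from noncrossing when the chord is an edge of a triangle, and is trivial for the base
  chord \<open>i = 0\<close>, \<open>j = m\<close>.\<close>

lemma triangle_below_edge:
  assumes "finite T" "\<And>\<sigma>. \<sigma> \<in> T \<Longrightarrow> \<exists>A\<subseteq>{0..m}. card A = 3 \<and> \<sigma> = tri A"
    and cover: "\<Union>T = tri {0..m}"
    and ij: "Suc i < j" "j \<le> m"
    and sides: "\<And>A. tri A \<in> T \<Longrightarrow> A \<subseteq> {0..m} \<Longrightarrow> A \<subseteq> {i..j} \<or> A \<inter> {i<..<j} = {}"
  shows "\<exists>l. i < l \<and> l < j \<and> tri {i, l, j} \<in> T"
proof -
  \<comment> \<open>Some triangle contains \<open>M\<close> and points just below the chord, so it lies below the chord;
    as it contains \<open>M\<close>, it has \<open>v i\<close> and \<open>v j\<close> as vertices.\<close>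
  define M where "M = midpoint (v i) (v j)"
  define S where "S = open_segment M (v (Suc i))"
  have val: "w \<bullet> M + c = ((w \<bullet> v i + c) + (w \<bullet> v j + c)) / 2" for w c
    by (simp add: M_def midpoint_def inner_add_right field_simps)
  obtain w c where w: "\<And>k. w \<bullet> v k + c = (real k - real i) * (real k - real j)"
    using split_quadratic[of "real i" "real j"] by blast
  have M0: "w \<bullet> M + c = 0" by (simp add: val w)
  have neg: "w \<bullet> v (Suc i) + c < 0" using ij by (simp add: w)
  have S_neg: "w \<bullet> x + c < 0" if "x \<in> S" for x
  proof -
    from that obtain u where u: "0 < u" and x: "x = (1 - u) *\<^sub>R M + u *\<^sub>R v (Suc i)"
      by (auto simp: S_def in_segment)
    have "w \<bullet> x + c = (1 - u) * (w \<bullet> M + c) + u * (w \<bullet> v (Suc i) + c)"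
      by (simp add: x inner_add_right algebra_simps)
    then show ?thesis using M0 neg u by (simp add: mult_pos_neg)
  qed
  have "M \<noteq> v (Suc i)" using M0 neg by auto
  then have "M \<in> closure S" by (simp add: S_def)
  have "v i \<in> tri {0..m}" "v j \<in> tri {0..m}" "v (Suc i) \<in> tri {0..m}"
    using ij by (simp_all add: vertex_in_tri_iff)
  moreover have conv: "convex (tri {0..m})" by (simp add: tri_def)
  ultimately have "M \<in> tri {0..m}"
    by (metis M_def convex_contains_segment midpoint_in_closed_segment subsetD)
  then have "S \<subseteq> tri {0..m}"
    using conv \<open>v (Suc i) \<in> _\<close> unfolding S_def
    by (metis convex_contains_open_segment)
  \<comment> \<open>\<open>S\<close> accumulates at \<open>M\<close> and finitely many closed sets
    cover it, so one triangle has points of \<open>S\<close> arbitrarily near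
    \<open>M\<close>.\<close>
  have "S \<subseteq> (\<Union>\<sigma>\<in>T. closure (S \<inter> \<sigma>))"
  proof
    fix x assume "x \<in> S"
    then have "x \<in> \<Union>T" unfolding cover using \<open>S \<subseteq> tri {0..m}\<close> by (rule subsetD[rotated])
    then obtain \<sigma> where "\<sigma> \<in> T" "x \<in> \<sigma>" by (rule UnionE)
    then show "x \<in> (\<Union>\<sigma>\<in>T. closure (S \<inter> \<sigma>))"
      using \<open>x \<in> S\<close> by (intro UN_I subsetD[OF closure_subset]) simp_all
  qed
  moreover have "closed (\<Union>\<sigma>\<in>T. closure (S \<inter> \<sigma>))"
    using \<open>finite T\<close> by (simp add: closed_UN)
  ultimately have "M \<in> (\<Union>\<sigma>\<in>T. closure (S \<inter> \<sigma>))"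
    using \<open>M \<in> closure S\<close> closure_minimal by blast
  then obtain \<sigma> where \<sigma>: "\<sigma> \<in> T" "M \<in> closure (S \<inter> \<sigma>)" by blast
  obtain A where A: "A \<subseteq> {0..m}" "card A = 3" "\<sigma> = tri A" using assms(2) \<sigma>(1) by blast
  have "finite A" using A(1) finite_subset by blast
  then have "closed \<sigma>"
    unfolding A tri_def by (simp add: compact_imp_closed finite_imp_compact_convex_hull)
  then have MA: "M \<in> tri A"
    using \<sigma>(2) closure_minimal[of "S \<inter> \<sigma>" \<sigma>] A(3) by blast
  have "S \<inter> \<sigma> \<noteq> {}" using \<sigma>(2) by (intro notI) (simp only: closure_empty empty_iff)
  then obtain x where x: "x \<in> S" "x \<in> tri A" using A(3) by auto
  \<comment> \<open>Otherwise \<open>sides\<close> puts all vertices of \<open>A\<close> where the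
    functional is nonnegative, although it is negative at the point \<open>x\<close> of the
    triangle.\<close>
  have sub: "A \<subseteq> {i..j}"
  proof (rule ccontr)
    assume "\<not> ?thesis"
    then have disj: "A \<inter> {i<..<j} = {}" using sides A \<sigma>(1) by blast
    have "0 \<le> w \<bullet> v k + c" if "k \<in> A" for k
    proof -
      have "k \<notin> {i<..<j}" using disj that by blast
      then have "k \<le> i \<or> j \<le> k" by auto
      then show ?thesis
        unfolding w using ij(1) by (auto intro: mult_nonpos_nonpos)
    qed
    then have "0 \<le> w \<bullet> x + c"
      using x(2) by (intro convex_hull_affine_ge[of x "v ` A"]) (auto simp: tri_def)
    then show False using S_neg x(1) by force
  qed
  \<comment> \<open>Without \<open>i\<close> all vertices have indices from \<open>i + 1\<close> to
    \<open>j\<close>. The functional with these two roots is nonpositive on them, yet positive at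
    \<open>M\<close>, where it is the mean of its values at \<open>v i\<close> and
    \<open>v j\<close>. The argument for \<open>j\<close> is the mirror image, with root
    \<open>j - 1\<close>.\<close>
  have "i \<in> A"
  proof (rule ccontr)
    assume "i \<notin> A"
    obtain w' c' where w': "\<And>k. w' \<bullet> v k + c' = (real k - real (Suc i)) * (real k - real j)"
      using split_quadratic[of "real (Suc i)" "real j"] by blast
    have "Suc i \<le> k \<and> k \<le> j" if "k \<in> A" for k
      using sub that \<open>i \<notin> A\<close> by (metis atLeastAtMost_iff le_antisym not_less_eq_eq subsetD)
    then have "0 \<le> (- w') \<bullet> v k + - c'" if "k \<in> A" for k
      using that w'[of k] mult_nonneg_nonpos[of "real k - real (Suc i)" "real k - real j"]
      by fastforce
    then have "0 \<le> (- w') \<bullet> M + - c'"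
      using MA by (intro convex_hull_affine_ge[of M "v ` A"]) (auto simp: tri_def)
    then show False using val[of w' c'] w'[of i] w'[of j] ij by simp
  qed
  moreover have "j \<in> A"
  proof (rule ccontr)
    assume "j \<notin> A"
    obtain w' c' where w': "\<And>k. w' \<bullet> v k + c' = (real k - real i) * (real k - real (j - 1))"
      using split_quadratic[of "real i" "real (j - 1)"] by blast
    have "i \<le> k \<and> k \<le> j - 1" if "k \<in> A" for k
    proof -
      have "k \<in> {i..j}" "k \<noteq> j" using sub that \<open>j \<notin> A\<close> by auto
      then show ?thesis by auto
    qed
    then have "0 \<le> (- w') \<bullet> v k + - c'" if "k \<in> A" for k
      using that w'[of k] mult_nonneg_nonpos[of "real k - real i" "real k - real (j - 1)"]
      by fastforce
    then have "0 \<le> (- w') \<bullet> M + - c'"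
      using MA by (intro convex_hull_affine_ge[of M "v ` A"]) (auto simp: tri_def)
    then show False using val[of w' c'] w'[of i] w'[of j] ij by simp
  qed
  ultimately have "card (A - {i, j}) = 1"
    using A(2) \<open>finite A\<close> ij by (simp add: card_Diff_subset)
  then obtain l where l: "A - {i, j} = {l}" by (auto simp: card_1_singleton_iff)
  then have "A = {i, l, j}" using \<open>i \<in> A\<close> \<open>j \<in> A\<close> by blast
  moreover have "l \<in> A" "l \<noteq> i" "l \<noteq> j" using l by blast+
  then have "i < l" "l < j" using subsetD[OF sub \<open>l \<in> A\<close>] by auto
  ultimately show ?thesis using A(3) \<sigma>(1) by metis
qed

text \<open>The crossing point lies in the common face, and a face containing an inner point of a
  segment contains its ends. So \<open>c\<close> and \<open>d\<close> would join \<open>a\<close>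
  and \<open>b\<close> in \<open>A\<close>, giving a triangle four vertices.\<close>

lemma triangle_edges_noncrossing:
  assumes T: "triangulation T" and AB: "tri A \<in> T" "tri B \<in> T" "card A = 3"
    and in_AB: "a \<in> A" "b \<in> A" "c \<in> B" "d \<in> B" and ord: "a < c" "c < b" "b < d"
  shows False
proof -
  obtain x where x: "x \<in> open_segment (v a) (v b)" "x \<in> open_segment (v c) (v d)"
    using chords_meet[OF ord] .
  have vin: "v a \<in> tri A" "v b \<in> tri A" "v c \<in> tri B" "v d \<in> tri B"
    using in_AB by (simp_all add: vertex_in_tri_iff)
  have "x \<in> tri A \<inter> tri B"
    using x vin convex_contains_open_segment[of "tri A"] convex_contains_open_segment[of "tri B"]
    unfolding tri_def by fastforce
  moreover have "(tri B \<inter> tri A) face_of tri B"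
    using T AB unfolding triangulation_def by blast
  ultimately have "v c \<in> tri A" "v d \<in> tri A"
    using face_ofD[of "tri B \<inter> tri A" "tri B"] x vin by blast+
  then have "{a, b, c, d} \<subseteq> A" using in_AB by (simp add: vertex_in_tri_iff)
  then have "card {a, b, c, d} \<le> card A"
    using AB(3) by (intro card_mono) (auto intro: card_ge_0_finite)
  then show False using ord AB(3) by simp
qed

lemma polygon_triangle_eq_tri:
  assumes T: "polygon_triangulation (tri {0..m}) T" "\<sigma> \<in> T"
  shows "\<exists>A\<subseteq>{0..m}. card A = 3 \<and> \<sigma> = tri A"
proof -
  have "2 simplex \<sigma>" and ext: "\<And>x. x extreme_point_of \<sigma> \<Longrightarrow> x extreme_point_of tri {0..m}"
    using T by (simp_all add: polygon_triangulation_def)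
  then obtain K where K: "\<not> affine_dependent K" "int (card K) = 2 + 1" "\<sigma> = convex hull K"
    unfolding simplex_def by metis
  have "y \<in> v ` {0..m}" if "y \<in> K" for y
  proof -
    have "y extreme_point_of \<sigma>"
      using K that by (simp add: extreme_point_of_convex_hull_affine_independent)
    then show ?thesis
      using ext extreme_point_of_tri_iff[of "{0..m}" y] by simp
  qed
  then obtain A where A: "A \<subseteq> {0..m}" "K = v ` A"
    by (metis subset_imageE subsetI)
  moreover have "card A = 3"
    using K(2) A by (simp add: card_image inj_on_subset[OF inj_v])
  ultimately show ?thesis using K by (auto simp: tri_def)
qed

section \<open>Translation into families of index triples\<close>

definition index_triples :: "nat \<Rightarrow> (real^2) set set \<Rightarrow> nat set set"
  where "index_triples m T = {A. A \<subseteq> {0..m} \<and> card A = 3 \<and> tri A \<in> T}"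

lemma tri_index_triples:
  assumes "polygon_triangulation (tri {0..m}) T"
  shows "tri ` index_triples m T = T"
proof
  show "tri ` index_triples m T \<subseteq> T" by (auto simp: index_triples_def)
  show "T \<subseteq> tri ` index_triples m T"
  proof
    fix \<sigma> assume "\<sigma> \<in> T"
    then obtain A where "A \<subseteq> {0..m}" "card A = 3" "\<sigma> = tri A"
      using polygon_triangle_eq_tri[OF assms] by metis
    then show "\<sigma> \<in> tri ` index_triples m T"
      using \<open>\<sigma> \<in> T\<close> by (simp add: index_triples_def)
  qed
qed

lemma interval_triangulation_index_triples:
  assumes T: "polygon_triangulation (tri {0..m}) T"
  shows "interval_triangulation (index_triples m T) (\<lambda>A. measure lborel (tri A)) (\<bar>dt\<bar> / 2)"
proof
  have tT: "triangulation T" and cover: "\<Union>T = tri {0..m}"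
    using T by (auto simp: polygon_triangulation_def)
  then have "finite T" by (simp add: triangulation_def)
  have "index_triples m T \<subseteq> Pow {0..m}" by (auto simp: index_triples_def)
  then show "finite (index_triples m T)" by (rule finite_subset) simp
  show "card A = 3" if "A \<in> index_triples m T" for A
    using that by (simp add: index_triples_def)
  show nc: False if "A \<in> index_triples m T" "B \<in> index_triples m T" "a \<in> A" "b \<in> A" "c \<in> B" "d \<in> B"
    "a < c" "c < b" "b < d" for A B a b c d
    using that triangle_edges_noncrossing[OF tT, of A B a b c d] by (auto simp: index_triples_def)
  show "measure lborel (tri {i, j, k}) =
    \<bar>dt\<bar> / 2 * ((real j - real i) * (real k - real j) * (real k - real i))" if "i < j" "j < k" for i j k
    using that by (rule measure_tri)
  show "\<exists>l. i < l \<and> l < j \<and> {i, l, j} \<in> index_triples m T"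
    if A: "A \<in> index_triples m T" "i \<in> A" "j \<in> A" and ij: "Suc i < j" for A i j
  proof -
    have jm: "j \<le> m" using A by (auto simp: index_triples_def)
    have "B \<subseteq> {i..j} \<or> B \<inter> {i<..<j} = {}" if B: "tri B \<in> T" "B \<subseteq> {0..m}" for B
    proof (rule ccontr)
      assume "\<not> ?thesis"
      then obtain x y where x: "x \<in> B" "i < x" "x < j" and y: "y \<in> B" "y < i \<or> j < y"
        by fastforce
      \<comment> \<open>Only \<open>tri B \<in> T\<close> is known here; that \<open>B\<close> has
        three elements comes from the injectivity of \<open>tri\<close>.\<close>
      obtain B' where "B' \<subseteq> {0..m}" "card B' = 3" "tri B = tri B'"
        using polygon_triangle_eq_tri[OF T B(1)] by blast
      then have "B \<in> index_triples m T"
        using B inj_tri by (auto simp: index_triples_def dest: injD)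
      then show False
        \<comment> \<open>The edge from \<open>x\<close> to \<open>y\<close> crosses the one from
          \<open>i\<close> to \<open>j\<close>; the two instances treat \<open>y < i\<close> and
          \<open>j < y\<close>.\<close>
        using nc[of B A y x i j] nc[of A B i j x y] A x y by metis
    qed
    then have "\<exists>l. i < l \<and> l < j \<and> tri {i, l, j} \<in> T"
      using triangle_below_edge[OF \<open>finite T\<close> polygon_triangle_eq_tri[OF T] cover ij jm] by metis
    then show ?thesis using jm by (auto simp: index_triples_def)
  qed
qed

text \<open>Starts the recursion: the base chord from \<open>0\<close> to \<open>m\<close> has all
  other vertices on one side, so no triangle can straddle it.\<close>

lemma root_triangle:
  assumes T: "polygon_triangulation (tri {0..m}) T" and m: "Suc 0 < m"
  shows "\<exists>l. 0 < l \<and> l < m \<and> {0, l, m} \<in> index_triples m T"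
proof -
  have "finite T" "\<Union>T = tri {0..m}"
    using T by (auto simp: polygon_triangulation_def triangulation_def)
  then have "\<exists>l. 0 < l \<and> l < m \<and> tri {0, l, m} \<in> T"
    using triangle_below_edge[OF _ polygon_triangle_eq_tri[OF T] _ m order_refl] by metis
  then show ?thesis by (auto simp: index_triples_def)
qed

section \<open>Coordinates and norm of the area vector\<close>

text \<open>After exchanging the sums, each triangle contributes its area once for every vertex
  \<open>i\<close> with \<open>j \<le> i\<close>, because \<open>staircase e i\<close> has
  coordinate 1 along \<open>e j\<close> exactly then and 0 otherwise.\<close>

lemma area_vector_eq_load:
  assumes T: "polygon_triangulation (tri {0..m}) T"
    and e: "bij_betw e {1..m} (Basis :: (real^'d::finite) set)" and j: "j \<in> {1..m}"
  shows "area_vector m v (staircase e) T \<bullet> e j =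
    load (\<lambda>A. measure lborel (tri A)) (index_triples m T) j"
proof -
  let ?F = "index_triples m T"
  have finF: "finite ?F" and sub: "\<And>A. A \<in> ?F \<Longrightarrow> A \<subseteq> {0..m}"
    by (auto simp: index_triples_def intro: finite_subset[of _ "Pow {0..m}"])
  have ee: "e k \<bullet> e j = (if k = j then 1 else 0)" if "k \<in> {1..m}" for k
  proof -
    have "e k \<in> Basis" "e j \<in> Basis" using e that j by (auto dest: bij_betw_apply)
    moreover have "e k = e j \<longleftrightarrow> k = j"
      using bij_betw_imp_inj_on[OF e] that j by (rule inj_on_eq_iff)
    ultimately show ?thesis by (simp add: inner_Basis)
  qed
  have fe: "staircase e i \<bullet> e j = (if j \<le> i then 1 else 0)" if "i \<in> {0..m}" for i
  proof -
    have "staircase e i \<bullet> e j = (\<Sum>k=1..i. if k = j then 1 else 0)"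
      unfolding staircase_def inner_sum_left using that by (intro sum.cong ee) auto
    then show ?thesis using j by (simp add: sum.delta)
  qed
  have tri_sets: "{\<sigma>. \<sigma> \<in> T \<and> v i extreme_point_of \<sigma>} = tri ` {A \<in> ?F. i \<in> A}" for i
  proof -
    have "v i extreme_point_of tri A \<longleftrightarrow> i \<in> A" if "A \<in> ?F" for A
      using extreme_point_of_tri_iff[of A "v i"] finite_subset[OF sub[OF that]] inj_v
      by (simp add: inj_image_mem_iff)
    then show ?thesis
      by (subst tri_index_triples[OF T, symmetric]) blast
  qed
  have "area_vector m v (staircase e) T \<bullet> e j =
      (\<Sum>i=0..m. \<Sum>A | A \<in> ?F \<and> i \<in> A. measure lborel (tri A) * (staircase e i \<bullet> e j))"
    unfolding area_vector_def tri_sets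
    by (simp add: inner_sum_left sum.reindex inj_on_subset[OF inj_tri])
  also have "\<dots> = (\<Sum>i=0..m. \<Sum>A\<in>?F. if i \<in> A \<and> j \<le> i then measure lborel (tri A) else 0)"
    by (rule sum.cong[OF refl], subst sum.inter_filter[OF finF]) (auto simp: fe intro!: sum.cong)
  also have "\<dots> = (\<Sum>A\<in>?F. \<Sum>i=0..m. if i \<in> A \<and> j \<le> i then measure lborel (tri A) else 0)"
    by (rule sum.swap)
  also have "\<dots> = load (\<lambda>A. measure lborel (tri A)) ?F j"
    unfolding load_def
  proof (intro sum.cong refl)
    fix A assume "A \<in> ?F"
    then have "{i \<in> {0..m}. i \<in> A \<and> j \<le> i} = {i \<in> A. j \<le> i}" using sub by blast
    then show "(\<Sum>i=0..m. if i \<in> A \<and> j \<le> i then measure lborel (tri A) else 0) =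
        measure lborel (tri A) * real (card {i \<in> A. j \<le> i})"
      by (simp flip: sum.inter_filter)
  qed
  finally show ?thesis .
qed

text \<open>The case \<open>lo = 0\<close>, \<open>hi = m\<close> of \<open>load_sums\<close>, read
  in the orthonormal basis \<open>e\<close>; the value does not mention \<open>T\<close>.\<close>

lemma norm_area_vector:
  assumes T: "polygon_triangulation (tri {0..m}) T" and m: "Suc 0 < m"
    and e: "bij_betw e {1..m} (Basis :: (real^'d::finite) set)"
  shows "norm (area_vector m v (staircase e) T) =
    sqrt ((\<bar>dt\<bar> / 2)\<^sup>2 * (2/7 * m ^ 7 - 3/5 * m ^ 5 + 1/3 * m ^ 3 - 2/105 * m))"
proof -
  let ?x = "area_vector m v (staircase e) T" and ?F = "index_triples m T"
  interpret interval_triangulation ?F "\<lambda>A. measure lborel (tri A)" "\<bar>dt\<bar> / 2"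
    by (rule interval_triangulation_index_triples[OF T])
  have all: "inside 0 m = ?F" unfolding inside_def by (auto simp: index_triples_def)
  have "?x \<bullet> ?x = (\<Sum>b\<in>Basis. (?x \<bullet> b)\<^sup>2)"
    by (subst euclidean_inner) (simp add: power2_eq_square)
  also have "\<dots> = (\<Sum>j\<in>{0<..m}. (?x \<bullet> e j)\<^sup>2)"
    using e sum.reindex_bij_betw[OF e, of "\<lambda>b. (?x \<bullet> b)\<^sup>2"]
    by (simp add: atLeastSucAtMost_greaterThanAtMost)
  also have "\<dots> = (\<Sum>j\<in>{0<..m}. (load (\<lambda>A. measure lborel (tri A)) (inside 0 m) j)\<^sup>2)"
    using area_vector_eq_load[OF T e] by (intro sum.cong) (auto simp: all)
  also have "\<dots> = (\<bar>dt\<bar> / 2)\<^sup>2 * (2/7 * m ^ 7 - 3/5 * m ^ 5 + 1/3 * m ^ 3 - 2/105 * m)"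
    using load_sums[of 0 m] root_triangle[OF T m] m by simp
  finally show ?thesis by (simp add: norm_eq_sqrt_inner)
qed

end

section \<open>From the given curve to quadratic points\<close>

text \<open>Independence makes the determinant of the linear and quadratic coefficients nonzero, and
  substituting a + k b for the parameter multiplies it by b^3.\<close>

lemma curve_point_quadratic:
  assumes "degree p \<le> 2" "degree q \<le> 2"
    and indep: "\<And>\<alpha> \<beta> \<gamma>. smult \<alpha> p + smult \<beta> q + smult \<gamma> 1 = 0 \<Longrightarrow> \<alpha> = 0 \<and> \<beta> = 0 \<and> \<gamma> = 0"
    and "b \<noteq> 0"
  shows "\<exists>u0 u1 u2. quadratic_points (curve_point p q a b) u0 u1 u2"
proof -
  have rep: "r = [:coeff r 0, coeff r 1, coeff r 2:]" if "degree r \<le> 2" for r :: "real poly"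
  proof (rule poly_eqI)
    fix k show "coeff r k = coeff [:coeff r 0, coeff r 1, coeff r 2:] k"
      using that coeff_eq_0[of r k]
      by (cases "k \<le> 2") (auto simp: coeff_pCons numeral_2_eq_2 le_Suc_eq split: nat.split)
  qed
  obtain p0 p1 p2 q0 q1 q2 where p: "p = [:p0, p1, p2:]" and q: "q = [:q0, q1, q2:]"
    using rep assms(1,2) by blast
  have det: "p1 * q2 - p2 * q1 \<noteq> 0"
  proof
    assume 0: "p1 * q2 - p2 * q1 = 0"
    \<comment> \<open>The quadratic terms cancel, the linear coefficient is the vanishing
      determinant, and the constant is subtracted off; independence then forces
      \<open>p2 = q2 = 0\<close>. The next combination treats the linear coefficients in the same
      way.\<close>
    have "smult q2 p + smult (- p2) q + smult (p2 * q0 - q2 * p0) 1 = 0"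
      using 0 by (simp add: p q one_pCons algebra_simps)
    then have "q2 = 0" "p2 = 0" using indep by fastforce+
    then have "smult q1 p + smult (- p1) q + smult (p1 * q0 - q1 * p0) 1 = 0"
      by (simp add: p q one_pCons algebra_simps)
    then have "q1 = 0" "p1 = 0" using indep by fastforce+
    then have "smult 1 p + smult 0 q + smult (- p0) 1 = 0"
      using \<open>p2 = 0\<close> by (simp add: p q one_pCons)
    then show False using indep by fastforce
  qed
  \<comment> \<open>Taylor coefficients of \<open>p\<close> and \<open>q\<close> at
    \<open>a\<close>, in the variable \<open>k\<close>.\<close>
  let ?u0 = "vector [poly p a, poly q a] :: real^2"
  let ?u1 = "vector [b * (p1 + 2 * a * p2), b * (q1 + 2 * a * q2)] :: real^2"
  let ?u2 = "vector [b\<^sup>2 * p2, b\<^sup>2 * q2] :: real^2"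
  have "quadratic_points (curve_point p q a b) ?u0 ?u1 ?u2"
  proof
    show "curve_point p q a b k = ?u0 + real k *\<^sub>R ?u1 + (real k)\<^sup>2 *\<^sub>R ?u2" for k
      by (simp add: curve_point_def vec_eq_iff forall_2 p q algebra_simps power2_eq_square)
    have "?u1 $ 1 * ?u2 $ 2 - ?u2 $ 1 * ?u1 $ 2 = b ^ 3 * (p1 * q2 - p2 * q1)"
      by simp algebra
    then show "?u1 $ 1 * ?u2 $ 2 - ?u2 $ 1 * ?u1 $ 2 \<noteq> 0"
      using det \<open>b \<noteq> 0\<close> by simp
  qed
  then show ?thesis by blast
qed

theorem theorem3p1:
  fixes n :: nat
    and p q :: "real poly"
    and a b :: real
    and v :: "nat \<Rightarrow> real^2"
    and e f :: "nat \<Rightarrow> real^'d"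
  assumes "degree p \<le> 2" and "degree q \<le> 2"
    and "\<And>\<alpha> \<beta> \<gamma>. smult \<alpha> p + smult \<beta> q + smult \<gamma> 1 = 0 \<Longrightarrow> \<alpha> = 0 \<and> \<beta> = 0 \<and> \<gamma> = 0"
    and "b \<noteq> 0"
    and "v = curve_point p q a b"
    and "CARD('d) = n + 2"
    and "bij_betw e {1..n + 2} (Basis :: (real^'d) set)"
    and "f = staircase e"
  shows "\<exists>r. {x. x extreme_point_of secondary_polytope (n + 2) v f} \<subseteq> sphere 0 r"
proof -
  obtain u0 u1 u2 where "quadratic_points v u0 u1 u2"
    using curve_point_quadratic[OF assms(1-4)] assms(5) by blast
  then interpret quadratic_points v u0 u1 u2 .
  \<comment> \<open>The common radius depends on \<open>n\<close> and \<open>dt\<close>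
    only.\<close>
  define r where "r = sqrt ((\<bar>dt\<bar> / 2)\<^sup>2 * (2/7 * real (n + 2) ^ 7 - 3/5 * real (n + 2) ^ 5
    + 1/3 * real (n + 2) ^ 3 - 2/105 * real (n + 2)))"
  have "norm x = r" if x: "x extreme_point_of secondary_polytope (n + 2) v f" for x
  proof -
    obtain T where "polygon_triangulation (tri {0..n + 2}) T" "x = area_vector (n + 2) v f T"
      using extreme_point_of_convex_hull[OF x[unfolded secondary_polytope_def]]
      by (auto simp: tri_def)
    then show ?thesis
      using norm_area_vector[of "n + 2" T e] assms(7,8) by (simp add: r_def)
  qed
  then show ?thesis by (intro exI[of _ r]) auto
qed

end
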